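(* For every integer $n\ge 2$ and every integer $k$ with $1\le k\le n$, \[\operatorname{ldim}\big(Q_n^{1,k}\big)\le \frac{n}{\log n}+\frac{2n\log\log n}{(\log n)^2}+3.\] More generally, for integers $1\le \ell<k\le n$ with $\ell<\frac{n}{\log n}$, $\operatorname{ldim}\big(Q_n^{\ell,k}\big)\le (1+o_\ell(1))\frac{n}{\log n}$, where $o_\ell(1)$ denotes a quantity tending to $0$ as $n\to\infty$ for each fixed $\ell$.
   Context: Logarithms are base 2. For $0\le a<b\le n$ (and for $a=b=1$, an antichain), $Q_n^{a,b}$ denotes the poset consisting of all $a$-element and all $b$-element subsets of $[n]$, ordered by inclusion. For a poset $P=(X,\le)$, a partial linear extension is a linear order $L=(Y,\le_L)$ with $Y\subseteq X$ such that $x\le y$ implies $x\le_L y$ for $x,y\in Y$. A local realiser is a set $\mathcal{L}$ of partial linear extensions such that for every ordered pair $(x,y)$ with $x\not\ge y$ some $L\in\mathcal{L}$ contains both and has $x\le_L y$. The multiplicity $\mu_{\mathcal{L}}(x)$ is the number of members of $\mathcal{L}$ containing $x$; the local dimension $\operatorname{ldim}(P)$ is the minimum over local realisers of $\max_x\mu_{\mathcal{L}}(x)$. *)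

theory Defs
  imports Complex_Main
begin

text \<open>
  A poset is represented by its reflexive order relation \<open>r\<close>, with ground set \<open>Field r\<close> and
  \<open>(x, y) \<in> r\<close> meaning \<open>x \<le> y\<close>; likewise a partial linear extension \<open>(Y, \<le>\<^sub>L)\<close> is represented
  by the relation \<open>L\<close>, with \<open>Y = Field L\<close>.
\<close>

definition partial_linear_extension :: "'a rel \<Rightarrow> 'a rel \<Rightarrow> bool" where
  "partial_linear_extension r L \<longleftrightarrow>
     Linear_order L \<and> Field L \<subseteq> Field r \<and>
     (\<forall>x\<in>Field L. \<forall>y\<in>Field L. (x, y) \<in> r \<longrightarrow> (x, y) \<in> L)"

definition local_realiser :: "'a rel \<Rightarrow> 'a rel set \<Rightarrow> bool" where
  "local_realiser r \<L> \<longleftrightarrow>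
     (\<forall>L\<in>\<L>. partial_linear_extension r L) \<and>
     (\<forall>x\<in>Field r. \<forall>y\<in>Field r. (y, x) \<notin> r \<longrightarrow>
        (\<exists>L\<in>\<L>. x \<in> Field L \<and> y \<in> Field L \<and> (x, y) \<in> L))"

definition multiplicity :: "'a rel set \<Rightarrow> 'a \<Rightarrow> nat" where
  "multiplicity \<L> x = card {L \<in> \<L>. x \<in> Field L}"

text \<open>
  Meant for finite non-empty posets: there every local realiser is finite, so the cardinalities and
  the maximum are the intended ones, and the infimum is an attained minimum, since local realisers
  exist (see \<open>local_realiser_all\<close> and \<open>ldim_attained\<close> below).
\<close>

definition ldim :: "'a rel \<Rightarrow> nat" where
  "ldim r = (INF \<L>\<in>{\<L>. local_realiser r \<L>}. Max (multiplicity \<L> ` Field r))"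

definition layers :: "nat \<Rightarrow> nat \<Rightarrow> nat \<Rightarrow> nat set set" where
  "layers n a b = {A. A \<subseteq> {1..n} \<and> (card A = a \<or> card A = b)}"

definition Q :: "nat \<Rightarrow> nat \<Rightarrow> nat \<Rightarrow> nat set rel" where
  "Q n a b = relation_of (\<subseteq>) (layers n a b)"

lemma Field_Q: "Field (Q n a b) = layers n a b"
  by (auto simp: Q_def relation_of_def Field_def)

lemma Partial_order_Q: "Partial_order (Q n a b)"
  unfolding Field_Q
  by (auto simp: Q_def relation_of_def order_on_defs refl_on_def trans_def antisym_def)

lemma finite_layers: "finite (layers n a b)"
  by (rule finite_subset[of _ "Pow {1..n}"]) (auto simp: layers_def)

lemma layers_nonempty:
  assumes "a \<le> n"
  shows "layers n a b \<noteq> {}"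
proof -
  have "{1..a} \<in> layers n a b"
    using assms by (auto simp: layers_def)
  then show ?thesis
    by blast
qed

lemma finite_partial_linear_extensions:
  assumes "finite (Field r)"
  shows "finite {L. partial_linear_extension r L}"
proof (rule finite_subset)
  show "{L. partial_linear_extension r L} \<subseteq> Pow (Field r \<times> Field r)"
    by (auto simp: partial_linear_extension_def dest: FieldI1 FieldI2)
  show "finite (Pow (Field r \<times> Field r))"
    using assms by simp
qed

lemma local_realiser_all:
  assumes "Partial_order r"
  shows "local_realiser r {L. partial_linear_extension r L}"
proof -
  have "\<exists>L. partial_linear_extension r L \<and> x \<in> Field L \<and> y \<in> Field L \<and> (x, y) \<in> L"
    if "x \<in> Field r" "y \<in> Field r" "(y, x) \<notin> r" for x y
  proof -
    let ?L = "{(x, x), (x, y), (y, y)}"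
    have F: "Field ?L = {x, y}"
      by (auto simp: Field_def)
    have "x \<noteq> y"
      using that assms by (auto simp: order_on_defs refl_on_def)
    then have "Linear_order ?L"
      unfolding F
      by (auto simp: order_on_defs refl_on_def trans_def antisym_def total_on_def)
    then have "partial_linear_extension r ?L"
      unfolding partial_linear_extension_def F using that by auto
    then show ?thesis
      unfolding F[symmetric] by (intro exI[of _ ?L]) (auto simp: F)
  qed
  then show ?thesis
    unfolding local_realiser_def by blast
qed

lemma ldim_attained:
  assumes "Partial_order r"
  shows "\<exists>\<L>. local_realiser r \<L> \<and> ldim r = Max (multiplicity \<L> ` Field r)"
proof -
  let ?M = "(\<lambda>\<L>. Max (multiplicity \<L> ` Field r)) ` {\<L>. local_realiser r \<L>}"
  have "?M \<noteq> {}"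
    using local_realiser_all[OF assms] by blast
  then have "Inf ?M \<in> ?M"
    by (rule Inf_nat_def1)
  then show ?thesis
    unfolding ldim_def by blast
qed

lemma ldim_le:
  assumes "local_realiser r \<L>"
  shows "ldim r \<le> Max (multiplicity \<L> ` Field r)"
  unfolding ldim_def using assms by (intro cINF_lower) auto

end

(*
  Cut the ground set into blocks B of size s. For every block B and every S \<subseteq> B take one partial
  linear extension that puts the k-sets A with A \<inter> B = S below the l-sets not contained in S
  within B. If X is an l-set and A a k-set with X - A nonempty, then A is below X in the extension
  given by a block meeting X - A and by the trace of A on it. All other pairs are reversed by two
  linear extensions of the whole poset. A k-set is used once per block, about n/s times, and an
  l-set at most l * 2^s times, so the optimal s is slightly smaller than log n.
*)
theory Submission
  imports Defs "HOL-Analysis.Convex" "HOL-Real_Asymp.Real_Asymp"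
begin

section \<open>Linear orders from integer keys\<close>

text \<open>Integer keys can be negated to reverse an order and shifted to move one layer past the
  other; injectivity on \<open>Y\<close> makes the order linear.\<close>

definition key_order :: "('a \<Rightarrow> int) \<Rightarrow> 'a set \<Rightarrow> 'a rel" where
  "key_order f Y = {(x, y). x \<in> Y \<and> y \<in> Y \<and> f x \<le> f y}"

lemma Field_key_order [simp]: "Field (key_order f Y) = Y"
  by (auto simp: key_order_def Field_def)

lemma in_key_order_iff [simp]: "(x, y) \<in> key_order f Y \<longleftrightarrow> x \<in> Y \<and> y \<in> Y \<and> f x \<le> f y"
  by (simp add: key_order_def)

lemma Linear_order_key_order:
  assumes "inj_on f Y"
  shows "Linear_order (key_order f Y)"
  using assms unfolding Field_key_order
  by (auto simp: order_on_defs refl_on_def trans_def antisym_def total_on_def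
      dest: inj_onD)

lemma partial_linear_extension_key_order:
  assumes "inj_on f Y" "Y \<subseteq> Field r"
    and "\<And>x y. x \<in> Y \<Longrightarrow> y \<in> Y \<Longrightarrow> (x, y) \<in> r \<Longrightarrow> f x \<le> f y"
  shows "partial_linear_extension r (key_order f Y)"
  using assms Linear_order_key_order[OF assms(1)]
  unfolding partial_linear_extension_def Field_key_order
  by auto

text \<open>The bound \<open>M\<close> is there to serve as a shift that separates the keys of two
  layers.\<close>

lemma ex_bounded_int_key:
  assumes "finite A"
  shows "\<exists>(c :: 'a \<Rightarrow> int) M. inj_on c A \<and> (\<forall>x\<in>A. 0 \<le> c x \<and> c x < M)"
proof -
  obtain f :: "'a \<Rightarrow> nat" and m where f: "f ` A = {i. i < m}" "inj_on f A"
    using finite_imp_inj_to_nat_seg[OF assms] by blast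
  have "inj_on (\<lambda>x. int (f x)) A"
    using f(2) by (auto simp: inj_on_def)
  moreover have "\<forall>x\<in>A. 0 \<le> int (f x) \<and> int (f x) < int m"
    using f(1) by auto
  ultimately show ?thesis
    by (intro exI[of _ "\<lambda>x. int (f x)"] exI[of _ "int m"]) simp
qed

lemma in_Q_iff: "(x, y) \<in> Q n a b \<longleftrightarrow> x \<in> layers n a b \<and> y \<in> layers n a b \<and> x \<subseteq> y"
  by (auto simp: Q_def relation_of_def)

lemma finite_layer_member: "x \<in> layers n a b \<Longrightarrow> finite x"
  by (auto simp: layers_def intro: finite_subset)

lemma ldim_leI:
  assumes "local_realiser r \<L>" "finite (Field r)" "Field r \<noteq> {}"
    and "\<And>x. x \<in> Field r \<Longrightarrow> multiplicity \<L> x \<le> m"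
  shows "ldim r \<le> m"
proof -
  have "Max (multiplicity \<L> ` Field r) \<le> m"
    using assms(2-4) by (intro Max.boundedI) auto
  then show ?thesis
    using ldim_le[OF assms(1)] by linarith
qed

text \<open>Any linear order of an antichain together with its reverse realises it. This covers
  \<open>k = 1\<close> in the first bound, where the block construction, which has
  \<open>a < b\<close>, does not apply.\<close>

lemma ldim_Q_antichain:
  assumes "a \<le> n"
  shows "ldim (Q n a a) \<le> 2"
proof -
  obtain c :: "nat set \<Rightarrow> int" where c: "inj_on c (layers n a a)"
    using ex_bounded_int_key[OF finite_layers] by blast
  define \<L> where "\<L> = {key_order c (layers n a a), key_order (\<lambda>x. - c x) (layers n a a)}"
  have eq: "x = y" if "(x, y) \<in> Q n a a" for x y
    using that card_subset_eq[OF finite_layer_member, of y n a a x]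
    by (simp add: in_Q_iff layers_def)
  have c': "inj_on (\<lambda>x. - c x) (layers n a a)"
    using c by (auto simp: inj_on_def)
  have "local_realiser (Q n a a) \<L>"
    unfolding local_realiser_def
  proof (intro conjI ballI impI)
    show "partial_linear_extension (Q n a a) L" if "L \<in> \<L>" for L
      using that c c' eq
      by (auto simp: \<L>_def Field_Q intro!: partial_linear_extension_key_order)
    show "\<exists>L\<in>\<L>. x \<in> Field L \<and> y \<in> Field L \<and> (x, y) \<in> L"
      if "x \<in> Field (Q n a a)" "y \<in> Field (Q n a a)" for x y
      using that by (cases "c x \<le> c y") (auto simp: \<L>_def Field_Q)
  qed
  moreover have "multiplicity \<L> x \<le> 2" for x
  proof -
    have "multiplicity \<L> x \<le> card \<L>"
      unfolding multiplicity_def by (intro card_mono) (auto simp: \<L>_def)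
    also have "\<dots> \<le> 2"
      by (simp add: \<L>_def card_insert_if)
    finally show ?thesis .
  qed
  ultimately show ?thesis
    by (intro ldim_leI) (auto simp: Field_Q finite_layers layers_nonempty assms)
qed

section \<open>The block construction\<close>

text \<open>Blocks start at 0 while the ground set is \<open>{1..n}\<close>, so the indices used run
  from 0 to \<open>n div s\<close>, which makes \<open>n div s + 1\<close> blocks.\<close>

definition block :: "nat \<Rightarrow> nat \<Rightarrow> nat set" where
  "block s j = {j * s..<j * s + s}"

lemma block_iff: "0 < s \<Longrightarrow> i \<in> block s j \<longleftrightarrow> i div s = j"
  using div_nat_eqI[of s j i] div_times_less_eq_dividend[of i s] dividend_less_div_times[of s i]
  by (auto simp: block_def algebra_simps)

text \<open>
  A \<open>b\<close>-set lies in exactly one of these families per block, whereas an \<open>a\<close>-set only lies in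
  families belonging to the at most \<open>a\<close> blocks that it meets.
\<close>

definition trace_family :: "nat \<Rightarrow> nat \<Rightarrow> nat \<Rightarrow> nat \<Rightarrow> nat \<Rightarrow> nat set \<Rightarrow> nat set set" where
  "trace_family n a b s j S = {x \<in> layers n a b.
     if card x = b then x \<inter> block s j = S else \<not> x \<inter> block s j \<subseteq> S}"

text \<open>The summand 2 counts the two extensions of the whole poset; the maximum compares the
  count for \<open>b\<close>-sets with that for \<open>a\<close>-sets.\<close>

lemma ldim_Q_le:
  assumes "a < b" "b \<le> n" "0 < s"
  shows "ldim (Q n a b) \<le> max (n div s + 1) (a * 2 ^ s) + 2"
proof -
  let ?F = "layers n a b"
  obtain c :: "nat set \<Rightarrow> int" and M
    where c: "inj_on c ?F" "\<And>x. x \<in> ?F \<Longrightarrow> 0 \<le> c x \<and> c x < M"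
    using ex_bounded_int_key[OF finite_layers] by metis
  \<comment> \<open>As \<open>0 \<le> c x < M\<close>, both \<open>up\<close> and \<open>up'\<close>
    place every \<open>b\<close>-set above every \<open>a\<close>-set, with opposite orders inside
    each layer, while \<open>down\<close> places every \<open>b\<close>-set below every
    \<open>a\<close>-set.\<close>
  define up where "up x = (if card x = b then M + c x else c x)" for x
  define up' where "up' x = (if card x = b then M - c x else - c x)" for x
  define down where "down x = (if card x = b then c x - M else c x)" for x
  define T where "T p = key_order down (trace_family n a b s (fst p) (snd p))" for p
  define I where "I = (SIGMA j:{..n div s}. Pow (block s j))"
  define E where "E = {key_order up ?F, key_order up' ?F}"
  define \<L> where "\<L> = E \<union> T ` I"
  have card_cases: "card x = a \<or> card x = b" if "x \<in> ?F" for x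
    using that by (auto simp: layers_def)
  have "inj_on f ?F" if "f \<in> {up, up', down}" for f
  proof (rule inj_onI)
    fix x y assume xy: "x \<in> ?F" "y \<in> ?F" "f x = f y"
    then have "c x = c y"
      using that c(2)[of x] c(2)[of y]
      by (auto simp: up_def up'_def down_def split: if_splits)
    then show "x = y"
      using c(1) xy by (meson inj_on_def)
  qed
  then have inj: "inj_on up ?F" "inj_on up' ?F" "inj_on down ?F"
    by simp_all
  have Qcases: "x = y \<or> card x = a \<and> card y = b" if "(x, y) \<in> Q n a b" for x y
  proof -
    have xy: "x \<in> ?F" "y \<in> ?F" "x \<subseteq> y"
      using that by (auto simp: in_Q_iff)
    note fin = finite_layer_member[OF xy(2)]
    show ?thesis
    proof (cases "card x = card y")
      case True
      then show ?thesis
        using card_subset_eq[OF fin xy(3)] by simp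
    next
      case False
      then show ?thesis
        using card_mono[OF fin xy(3)] card_cases[OF xy(1)] card_cases[OF xy(2)] assms(1)
        by linarith
    qed
  qed
  have full_mono: "f x \<le> f y" if "(x, y) \<in> Q n a b" "f \<in> {up, up'}" for f x y
    using Qcases[OF that(1)]
  proof
    assume "card x = a \<and> card y = b"
    moreover have "0 \<le> c x" "c x < M" "0 \<le> c y" "c y < M"
      using that(1) c(2) by (auto simp: in_Q_iff)
    ultimately show ?thesis
      using that(2) assms(1) by (auto simp: up_def up'_def)
  qed simp
  have real: "local_realiser (Q n a b) \<L>"
    unfolding local_realiser_def
  proof (intro conjI ballI impI)
    fix L assume "L \<in> \<L>"
    then consider f where "f \<in> {up, up'}" "L = key_order f ?F"
      | j S where "L = key_order down (trace_family n a b s j S)"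
      by (auto simp: \<L>_def E_def T_def)
    then show "partial_linear_extension (Q n a b) L"
    proof cases
      case 1
      have "inj_on f ?F"
        using 1(1) inj by auto
      moreover have "f x \<le> f y" if "(x, y) \<in> Q n a b" for x y
        using full_mono[OF that 1(1)] .
      ultimately show ?thesis
        unfolding 1(2) by (intro partial_linear_extension_key_order) (simp_all add: Field_Q)
    next
      case 2
      \<comment> \<open>If an \<open>a\<close>-set lay inside a \<open>b\<close>-set of the family,
        its trace would lie in \<open>S\<close>. So the family is an antichain, and any linear order
        on it is a partial linear extension.\<close>
      have "x = y" if "x \<in> trace_family n a b s j S" "y \<in> trace_family n a b s j S"
        "(x, y) \<in> Q n a b" for x y
        using Qcases[OF that(3)] that assms(1) by (auto simp: trace_family_def in_Q_iff)
      moreover have "trace_family n a b s j S \<subseteq> ?F"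
        by (auto simp: trace_family_def)
      ultimately show ?thesis
        using inj(3) unfolding 2
        by (intro partial_linear_extension_key_order) (auto simp: Field_Q intro: inj_on_subset)
    qed
  next
    fix x y assume xy: "x \<in> Field (Q n a b)" "y \<in> Field (Q n a b)" "(y, x) \<notin> Q n a b"
    then have F: "x \<in> ?F" "y \<in> ?F" "\<not> y \<subseteq> x"
      by (auto simp: Field_Q in_Q_iff)
    show "\<exists>L\<in>\<L>. x \<in> Field L \<and> y \<in> Field L \<and> (x, y) \<in> L"
    proof (cases "card x = b \<and> card y = a")
      case True
      \<comment> \<open>The element \<open>i\<close> selects the block, and \<open>S\<close> is the
        trace of \<open>x\<close> there; \<open>i\<close> itself shows that the trace of
        \<open>y\<close> is not inside \<open>S\<close>.\<close>
      obtain i where i: "i \<in> y" "i \<notin> x"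
        using F(3) by blast
      define j where "j = i div s"
      define S where "S = x \<inter> block s j"
      have "i \<le> n"
        using F(2) i(1) by (auto simp: layers_def)
      then have I: "(j, S) \<in> I"
        by (auto simp: I_def S_def j_def div_le_mono)
      have "i \<in> block s j"
        using assms(3) by (simp add: block_iff j_def)
      then have "x \<in> trace_family n a b s j S" "y \<in> trace_family n a b s j S"
        using F True i assms(1) by (auto simp: trace_family_def S_def)
      moreover have "T (j, S) \<in> \<L>"
        using I by (simp add: \<L>_def)
      moreover have "down x \<le> down y"
        using c(2)[OF F(1)] c(2)[OF F(2)] True assms(1) by (simp add: down_def)
      ultimately show ?thesis
        by (intro bexI[of _ "T (j, S)"]) (simp_all add: T_def)
    next
      case False
      \<comment> \<open>Inside one layer \<open>up\<close> and \<open>up'\<close> are opposite, so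
        one of them fits; for an \<open>a\<close>-set \<open>x\<close> and a \<open>b\<close>-set
        \<open>y\<close> both do.\<close>
      then have "up x \<le> up y \<or> up' x \<le> up' y"
        using c(2)[OF F(1)] c(2)[OF F(2)] card_cases[OF F(1)] card_cases[OF F(2)] assms(1)
        by (auto simp: up_def up'_def)
      then show ?thesis
        using F by (auto simp: \<L>_def E_def)
    qed
  qed
  have finI: "finite I"
    by (auto simp: I_def block_def)
  have mult: "multiplicity \<L> x \<le> max (n div s + 1) (a * 2 ^ s) + 2" if x: "x \<in> ?F" for x
  proof -
    \<comment> \<open>Distinct indices may give the same extension, so counting indices bounds the
      multiplicity from above.\<close>
    let ?J = "{p \<in> I. x \<in> trace_family n a b s (fst p) (snd p)}"
    have "multiplicity \<L> x \<le> card (E \<union> T ` ?J)"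
      unfolding multiplicity_def
      by (intro card_mono) (use finI in \<open>auto simp: \<L>_def E_def T_def\<close>)
    also have "\<dots> \<le> card E + card (T ` ?J)"
      by (rule card_Un_le)
    also have "\<dots> \<le> 2 + card ?J"
      using card_image_le[of ?J T] finI by (intro add_mono) (auto simp: E_def card_insert_if)
    also have "card ?J \<le> max (n div s + 1) (a * 2 ^ s)"
    proof (cases "card x = b")
      case True
      then have "?J \<subseteq> (\<lambda>j. (j, x \<inter> block s j)) ` {..n div s}"
        by (auto simp: I_def trace_family_def)
      then have "card ?J \<le> card {..n div s}"
        by (rule surj_card_le[rotated]) simp
      then show ?thesis
        by simp
    next
      case False
      then have a: "card x = a"
        using card_cases[OF x] by simp
      have fx: "finite x"
        using x by (rule finite_layer_member)
      \<comment> \<open>A block missed by \<open>x\<close> leaves the empty trace, which lies in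
        every \<open>S\<close>; only blocks of elements of \<open>x\<close> remain.\<close>
      have "?J \<subseteq> (SIGMA j:(\<lambda>i. i div s) ` x. Pow (block s j))"
        using False assms(3) by (auto simp: I_def trace_family_def block_iff)
      then have "card ?J \<le> card (SIGMA j:(\<lambda>i. i div s) ` x. Pow (block s j))"
        by (rule card_mono[rotated]) (use fx in \<open>auto simp: block_def\<close>)
      also have "\<dots> = card ((\<lambda>i. i div s) ` x) * 2 ^ s"
        using fx by (simp add: card_SigmaI block_def card_Pow)
      also have "\<dots> \<le> a * 2 ^ s"
        using card_image_le[OF fx, of "\<lambda>i. i div s"] a by simp
      finally show ?thesis
        by simp
    qed
    finally show ?thesis
      by simp
  qed
  show ?thesis
    using assms mult layers_nonempty[of a n b]
    by (intro ldim_leI[OF real]) (simp_all add: Field_Q finite_layers)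
qed

lemma real_ldim_Q_le:
  assumes "a < b" "b \<le> n" "0 < s"
  shows "real (ldim (Q n a b)) \<le> max (real n / real s + 1) (real a * 2 ^ s) + 2"
proof -
  have "real (ldim (Q n a b)) \<le> real (max (n div s + 1) (a * 2 ^ s) + 2)"
    using ldim_Q_le[OF assms] by (rule of_nat_mono)
  also have "\<dots> = max (real (n div s) + 1) (real a * 2 ^ s) + 2"
    by (simp add: of_nat_max)
  also have "\<dots> \<le> max (real n / real s + 1) (real a * 2 ^ s) + 2"
    using of_nat_div_le_of_nat[of n s, where ?'a = real] by (intro add_mono max.mono) auto
  finally show ?thesis .
qed

section \<open>Bounds on the binary logarithm\<close>

text \<open>By concavity the logarithm lies above its chord from 1 to 2.\<close>

lemma le_log2_one_plus:
  fixes x :: real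
  assumes "0 \<le> x" "x \<le> 1"
  shows "x \<le> log 2 (1 + x)"
proof -
  have "(1 - x) * ln 1 + x * ln 2 \<le> ln ((1 - x) * 1 + x * 2)"
    using concave_onD[OF ln_concave, of x 1 2] assms by simp
  then show ?thesis
    by (simp add: log_def field_simps)
qed

text \<open>Both sides equal 2 at 4, and the tangent of the logarithm there has slope
  \<open>1 / (4 * ln 2)\<close>, which is at most 1/2.\<close>

lemma log2_le_half:
  fixes x :: real
  assumes "4 \<le> x"
  shows "log 2 x \<le> x / 2"
proof -
  have "ln (x / 4) \<le> x / 4 - 1"
    using assms by (intro ln_le_minus_one) auto
  also have "\<dots> \<le> (x / 4 - 1) * (2 * ln 2)"
  proof -
    have "1 \<le> 2 * ln (2 :: real)"
      using ln_le_minus_one[of "1 / 2 :: real"] by (simp add: ln_div)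
    then show ?thesis
      using mult_left_mono[of 1 "2 * ln (2::real)" "x / 4 - 1"] assms by simp
  qed
  finally have "ln x - ln 4 \<le> (x / 2 - 2) * ln 2"
    using assms by (simp add: ln_div algebra_simps)
  moreover have "ln 4 = 2 * ln (2 :: real)"
    using ln_realpow[of 2 2] by simp
  ultimately have "ln x \<le> x / 2 * ln 2"
    by (simp add: algebra_simps)
  then show ?thesis
    by (simp add: log_def field_simps)
qed

text \<open>Both sides agree at 2 and at 4, so this is the chord bound again, after halving
  \<open>x\<close>.\<close>

lemma half_le_log2:
  fixes x :: real
  assumes "2 \<le> x" "x \<le> 4"
  shows "x / 2 \<le> log 2 x"
proof -
  have "x / 2 - 1 \<le> log 2 (1 + (x / 2 - 1))"
    using assms by (intro le_log2_one_plus) auto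
  also have "\<dots> = log 2 x - 1"
    using assms by (simp add: log_divide)
  finally show ?thesis
    by simp
qed

section \<open>Choice of the block size\<close>

text \<open>With \<open>a = 1\<close> the construction gives
  \<open>max (n / s + 1) (2 ^ s) + 2\<close>, so these two conditions yield \<open>F + 3\<close>.
  For large \<open>n\<close> the choice is \<open>s = \<lfloor>log 2 F\<rfloor>\<close>, which
  leaves only the first condition to work for.\<close>

lemma ex_block_size:
  assumes "2 \<le> n"
  defines "F \<equiv> real n / log 2 (real n)
              + 2 * real n * log 2 (log 2 (real n)) / (log 2 (real n))\<^sup>2"
  shows "\<exists>s > 0. real n / real s \<le> F \<and> 2 ^ s \<le> F + 1"
proof -
  define L where "L = log 2 (real n)"
  define m where "m = log 2 L"
  have F: "F = real n / L * (1 + 2 * m / L)"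
    by (simp add: F_def L_def m_def power2_eq_square algebra_simps)
  have L1: "1 \<le> L"
    using assms by (simp add: L_def le_log_iff)
  have m0: "0 \<le> m"
    using L1 by (simp add: m_def)
  have n: "real n = 2 powr L"
    using assms by (simp add: L_def)
  \<comment> \<open>The general argument uses \<open>2 \<le> m\<close> and
    \<open>log 2 L \<le> L / 2\<close>, both available for \<open>4 < L\<close>; smaller
    \<open>n\<close> take \<open>s = 1\<close> or \<open>s = 2\<close>.\<close>
  consider "n = 2" | "n = 3" | "4 \<le> n" "L \<le> 4" | "4 < L"
    using assms by linarith
  then show ?thesis
  proof cases
    case 1
    then have "L = 1" "m = 0"
      by (simp_all add: L_def m_def)
    then show ?thesis
      using 1 by (intro exI[of _ 1]) (simp add: F)
  next
    case 2
    \<comment> \<open>For \<open>s = 1\<close> the claim \<open>n \<le> F\<close> amounts to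
      \<open>L * L \<le> L + 2 * m\<close>. The comparisons 8 \<le> 9 and 243 \<le> 256 confine
      \<open>log 2 3\<close> to the interval from 3/2 to 8/5.\<close>
    have "log 2 (2 ^ 3) \<le> log 2 ((3::real) ^ 2)"
      by (subst log_le_cancel_iff) auto
    then have L2: "3 / 2 \<le> L"
      using 2 by (simp only: log_nat_power L_def) simp
    have "log 2 ((3::real) ^ 5) \<le> log 2 (2 ^ 8)"
      by (subst log_le_cancel_iff) auto
    then have L3: "L \<le> 8 / 5"
      using 2 by (simp only: log_nat_power L_def) simp
    have "1 / 2 \<le> log 2 (1 + 1 / 2 :: real)"
      by (rule le_log2_one_plus) auto
    also have "\<dots> \<le> m"
      unfolding m_def using L2 by (subst log_le_cancel_iff) auto
    finally have "L + 1 \<le> L + 2 * m"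
      by simp
    moreover have "L * L \<le> L + 1"
    proof -
      have "L * (L - 1) \<le> 8 / 5 * (3 / 5)"
        using L2 L3 by (intro mult_mono) auto
      then show ?thesis
        using L2 by (simp add: algebra_simps)
    qed
    ultimately have "L * L \<le> L + 2 * m"
      by simp
    then have "real n \<le> F"
      using 2 L2 by (simp add: F field_simps)
    then show ?thesis
      using 2 by (intro exI[of _ 1]) simp
  next
    case 3
    have L2: "2 \<le> L"
      using 3(1) by (simp add: L_def le_log_iff)
    \<comment> \<open>This makes the factor \<open>1 + 2 * m / L\<close> of \<open>F\<close> at
      least 2.\<close>
    have m: "L / 2 \<le> m"
      unfolding m_def using L2 3(2) by (rule half_le_log2)
    have F1: "real n / L * 2 \<le> F"
      unfolding F by (intro mult_left_mono) (use m L2 in \<open>auto simp: field_simps\<close>)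
    have "real n / 2 \<le> real n / L * 2"
      using 3 L2 by (simp add: field_simps)
    then have F2: "real n / 2 \<le> F"
      using F1 by simp
    \<comment> \<open>For \<open>s = 2\<close> the condition \<open>2 ^ s \<le> F + 1\<close> reads
      like this. If \<open>6 \<le> n\<close>, it follows from \<open>n / 2 \<le> F\<close>; for
      \<open>n\<close> equal to 4 or 5, from \<open>n ^ 3 \<le> 2 ^ 8\<close>, which gives
      \<open>L \<le> 8 / 3\<close>.\<close>
    have "3 \<le> F"
    proof (cases "6 \<le> n")
      case False
      have "log 2 (real n ^ 3) \<le> log 2 (2 ^ 8)"
      proof (subst log_le_cancel_iff)
        have "real n ^ 3 \<le> 5 ^ 3"
          using False by (intro power_mono) auto
        then show "real n ^ 3 \<le> 2 ^ 8"
          by simp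
      qed (use 3 in auto)
      then have "L \<le> 8 / 3"
        using 3 by (simp only: log_nat_power L_def) simp
      then have "3 \<le> real n / L * 2"
        using 3 L2 by (simp add: field_simps)
      then show ?thesis
        using F1 by simp
    qed (use F2 in simp)
    then show ?thesis
      using F2 by (intro exI[of _ 2]) simp
  next
    case 4
    define t where "t = 2 * m / L"
    have Lm: "L = 2 powr m"
      using L1 by (simp add: m_def)
    have m2: "2 \<le> m"
      using 4 by (simp add: m_def le_log_iff)
    have t: "0 \<le> t" "t \<le> 1"
      using m0 L1 log2_le_half[of L] 4 by (auto simp: t_def m_def)
    have logF: "log 2 F = L - m + log 2 (1 + t)"
      unfolding F t_def[symmetric] n
      using t L1 by (subst log_mult) (auto simp: log_divide m_def)
    have F0: "0 < F"
      unfolding F t_def[symmetric] using assms t L1 by simp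
    define s where "s = nat \<lfloor>log 2 F\<rfloor>"
    \<comment> \<open>Since \<open>F = n / L * (1 + t)\<close>, the goal
      \<open>n / s \<le> F\<close> means \<open>L / (1 + t) \<le> s\<close>; rounding down costs
      less than 1, so a bound by \<open>log 2 F - 1\<close> suffices.\<close>
    have "L / (1 + t) \<le> L - m + t - 1"
    proof -
      \<comment> \<open>With \<open>L * t = 2 * m\<close>, this product is exactly
        \<open>(L - m + t - 1) * (1 + t) - L\<close>.\<close>
      have "0 \<le> (1 - t) * (m - 1 - t)"
        using t m2 by simp
      moreover have "L * t = 2 * m"
        using L1 by (simp add: t_def)
      ultimately have "L \<le> (L - m + t - 1) * (1 + t)"
        by (simp add: algebra_simps)
      then show ?thesis
        using t by (simp add: field_simps)
    qed
    also have "\<dots> \<le> log 2 F - 1"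
      using le_log2_one_plus[OF t] by (simp add: logF)
    finally have low: "L / (1 + t) \<le> log 2 F - 1" .
    have pos: "0 < L / (1 + t)"
      using t L1 by simp
    then have s: "real s \<le> log 2 F" "log 2 F - 1 < real s"
      using low unfolding s_def by linarith+
    then have sL: "L / (1 + t) \<le> real s"
      using low by simp
    then have "0 < s"
      using pos by (cases s) auto
    moreover have "real n / real s \<le> F"
    proof -
      have "real n / real s \<le> real n / (L / (1 + t))"
        using sL pos \<open>0 < s\<close> by (intro divide_left_mono mult_pos_pos) simp_all
      then show ?thesis
        by (simp add: F t_def)
    qed
    moreover have "2 ^ s \<le> F"
      using s(1) F0 by (simp add: le_log_iff powr_realpow)
    ultimately show ?thesis
      by (intro exI[of _ s]) simp
  qed
qed

lemma ldim_Q_one_le: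
  assumes "2 \<le> n" "1 \<le> k" "k \<le> n"
  shows "real (ldim (Q n 1 k)) \<le>
           real n / log 2 (real n)
           + 2 * real n * log 2 (log 2 (real n)) / (log 2 (real n))\<^sup>2 + 3"
    (is "_ \<le> ?F + 3")
proof -
  obtain s where s: "0 < s" "real n / real s \<le> ?F" "2 ^ s \<le> ?F + 1"
    using ex_block_size[OF assms(1)] by blast
  show ?thesis
  proof (cases "k = 1")
    case True
    have "0 \<le> real n / real s"
      by simp
    then have "0 \<le> ?F"
      using s(2) by linarith
    moreover have "ldim (Q n 1 k) \<le> 2"
      unfolding True using assms by (intro ldim_Q_antichain) simp
    ultimately show ?thesis
      by linarith
  next
    case False
    then have "real (ldim (Q n 1 k)) \<le> max (real n / real s + 1) (real 1 * 2 ^ s) + 2"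
      using assms s(1) by (intro real_ldim_Q_le) auto
    then show ?thesis
      using s(2,3) by (auto simp: max_def split: if_splits)
  qed
qed

section \<open>Asymptotics for fixed \<open>l\<close>\<close>

lemma ldim_Q_asymptotic:
  "\<exists>\<epsilon> :: nat \<Rightarrow> real. \<epsilon> \<longlonglongrightarrow> 0 \<and>
     (\<forall>n k. l < k \<and> k \<le> n \<and> 1 < n \<longrightarrow>
        real (ldim (Q n l k)) \<le> (1 + \<epsilon> n) * (real n / log 2 (real n)))"
proof -
  \<comment> \<open>For large \<open>n\<close>, \<open>2 powr q n\<close> is n divided by the square
    of log n: the count for \<open>l\<close>-sets becomes o(n / log n), while \<open>q n\<close> is
    still asymptotic to log n.\<close>
  define q where "q n = log 2 (real n) - 2 * log 2 (log 2 (real n))" for n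
  \<comment> \<open>The maximum keeps the block size positive for small \<open>n\<close>.\<close>
  define s where "s n = max 1 (nat \<lfloor>q n\<rfloor>)" for n
  \<comment> \<open>Chosen so that \<open>(1 + \<epsilon> n) * (n / log 2 n)\<close> equals
    \<open>n / s n + l * 2 ^ s n + 3\<close> for every \<open>n > 1\<close>; this sum dominates the
    maximum plus 2 from the construction.\<close>
  define \<epsilon> where "\<epsilon> n =
    (real n / real (s n) + real l * 2 ^ s n + 3) * (log 2 (real n) / real n) - 1" for n
  \<comment> \<open>Upper bound for the sandwich: eventually \<open>q n - 1 < s n \<le> q n\<close>,
    so \<open>q n - 1\<close> replaces \<open>s n\<close> in the quotient and \<open>q n\<close>
    replaces it in the power.\<close>
  define g where "g n =
    (real n / (q n - 1) + real l * (real n / (log 2 (real n))\<^sup>2) + 3) * (log 2 (real n) / real n) - 1" for n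
  have up: "\<forall>\<^sub>F n in sequentially. \<epsilon> n \<le> g n"
  proof -
    have "\<forall>\<^sub>F n in sequentially. 2 \<le> q n"
      unfolding q_def by real_asymp
    then show ?thesis
      using eventually_ge_at_top[of 2]
    proof eventually_elim
      case (elim n)
      then have s: "real (s n) \<le> q n" "q n - 1 < real (s n)"
        unfolding s_def by linarith+
      have "real n / real (s n) \<le> real n / (q n - 1)"
        using s elim by (intro divide_left_mono) auto
      moreover have "2 ^ s n \<le> real n / (log 2 (real n))\<^sup>2"
      proof -
        have "2 powr (2 * log 2 (log 2 (real n))) = (2 powr log 2 (log 2 (real n))) powr 2"
          by (simp add: powr_powr mult.commute)
        also have "\<dots> = (log 2 (real n))\<^sup>2"
          using elim by simp
        finally have "2 powr q n = real n / (log 2 (real n))\<^sup>2"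
          using elim by (simp add: q_def powr_diff)
        then show ?thesis
          using s(1) powr_mono[of "real (s n)" "q n" 2] by (simp add: powr_realpow)
      qed
      ultimately show ?case
        unfolding \<epsilon>_def g_def using elim
        by (intro diff_right_mono mult_right_mono add_mono mult_left_mono) auto
    qed
  qed
  \<comment> \<open>Lower bound for the sandwich: only the term \<open>n / s n\<close> is kept, with
    \<open>s n \<le> q n\<close>.\<close>
  define h where "h n = log 2 (real n) / q n - 1" for n
  have low: "\<forall>\<^sub>F n in sequentially. h n \<le> \<epsilon> n"
  proof -
    have "\<forall>\<^sub>F n in sequentially. 2 \<le> q n"
      unfolding q_def by real_asymp
    then show ?thesis
      using eventually_ge_at_top[of 2]
    proof eventually_elim
      case (elim n)
      then have s: "real (s n) \<le> q n" "0 < real (s n)"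
        unfolding s_def by linarith+
      have "log 2 (real n) / q n \<le> log 2 (real n) / real (s n)"
        using s elim by (intro divide_left_mono) auto
      also have "\<dots> = (real n / real (s n)) * (log 2 (real n) / real n)"
        using elim by simp
      also have "\<dots> \<le> (real n / real (s n) + real l * 2 ^ s n + 3) * (log 2 (real n) / real n)"
        using elim by (intro mult_right_mono) auto
      finally show ?case
        by (simp add: \<epsilon>_def h_def)
    qed
  qed
  have "g \<longlonglongrightarrow> 0"
  proof -
    have "(\<lambda>n. real n / (q n - 1) * (log 2 (real n) / real n)) \<longlonglongrightarrow> 1"
      unfolding q_def by real_asymp
    moreover have "(\<lambda>n. real n / (log 2 (real n))\<^sup>2 * (log 2 (real n) / real n)) \<longlonglongrightarrow> 0"
      unfolding q_def by real_asymp
    moreover have "(\<lambda>n. 3 * (log 2 (real n) / real n)) \<longlonglongrightarrow> 0"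
      by real_asymp
    ultimately have "(\<lambda>n. real n / (q n - 1) * (log 2 (real n) / real n)
        + real l * (real n / (log 2 (real n))\<^sup>2 * (log 2 (real n) / real n))
        + 3 * (log 2 (real n) / real n) - 1) \<longlonglongrightarrow> 1 + real l * 0 + 0 - 1"
      by (intro tendsto_intros)
    then show ?thesis
      by (simp only: g_def[abs_def] distrib_right mult.assoc) simp
  qed
  moreover have "h \<longlonglongrightarrow> 0"
    unfolding h_def q_def by real_asymp
  ultimately have "\<epsilon> \<longlonglongrightarrow> 0"
    using low up by (intro tendsto_sandwich[of h \<epsilon> sequentially g])
  moreover have "real (ldim (Q n l k)) \<le> (1 + \<epsilon> n) * (real n / log 2 (real n))"
    if "l < k" "k \<le> n" "1 < n" for n k
  proof -
    have "real (ldim (Q n l k)) \<le> max (real n / real (s n) + 1) (real l * 2 ^ s n) + 2"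
      using that by (intro real_ldim_Q_le) (auto simp: s_def)
    also have "\<dots> \<le> real n / real (s n) + real l * 2 ^ s n + 3"
      by (simp add: max_def)
    also have "\<dots> = (1 + \<epsilon> n) * (real n / log 2 (real n))"
    proof -
      have "log 2 (real n) \<noteq> 0"
        using zero_less_log_cancel_iff[of 2 "real n"] that(3) by linarith
      then show ?thesis
        using that(3) by (simp add: \<epsilon>_def)
    qed
    finally show ?thesis .
  qed
  ultimately show ?thesis
    by blast
qed

theorem theorem14:
  shows "(\<forall>n k :: nat. 2 \<le> n \<and> 1 \<le> k \<and> k \<le> n \<longrightarrow>
            real (ldim (Q n 1 k)) \<le>
              real n / log 2 (real n)
              + 2 * real n * log 2 (log 2 (real n)) / (log 2 (real n))\<^sup>2 + 3)
       \<and> (\<forall>l :: nat. 1 \<le> l \<longrightarrow>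
            (\<exists>\<epsilon> :: nat \<Rightarrow> real. \<epsilon> \<longlonglongrightarrow> 0 \<and>
              (\<forall>n k :: nat. l < k \<and> k \<le> n \<and> real l < real n / log 2 (real n) \<longrightarrow>
                real (ldim (Q n l k)) \<le> (1 + \<epsilon> n) * (real n / log 2 (real n)))))"
proof (intro conjI allI impI)
  fix l :: nat
  assume "1 \<le> l"
  obtain \<epsilon> :: "nat \<Rightarrow> real" where "\<epsilon> \<longlonglongrightarrow> 0"
    and "\<And>n k. l < k \<Longrightarrow> k \<le> n \<Longrightarrow> 1 < n \<Longrightarrow>
      real (ldim (Q n l k)) \<le> (1 + \<epsilon> n) * (real n / log 2 (real n))"
    using ldim_Q_asymptotic by blast
  \<comment> \<open>The chain \<open>1 \<le> l < k \<le> n\<close> supplies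
    \<open>1 < n\<close>.\<close>
  with \<open>1 \<le> l\<close> show "\<exists>\<epsilon> :: nat \<Rightarrow> real. \<epsilon> \<longlonglongrightarrow> 0 \<and>
      (\<forall>n k :: nat. l < k \<and> k \<le> n \<and> real l < real n / log 2 (real n) \<longrightarrow>
        real (ldim (Q n l k)) \<le> (1 + \<epsilon> n) * (real n / log 2 (real n)))"
    by (intro exI[of _ \<epsilon>]) auto
qed (use ldim_Q_one_le in blast)

end
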